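(* Let $(R,A,f,n)$ be any request-answer game. Writing $\mathrm{CR}_{X}$ for $\mathrm{CR}_{\Delta_X(R^n)}(R,A,f,n)$ and $\overline{\mathrm{CR}}_{X}$ for $\overline{\mathrm{CR}}_{\Delta_X(R^n)}(R,A,f,n)$, the following hold: \begin{align*} &\overline{\mathrm{CR}}_{\det}\le \overline{\mathrm{CR}}_{\mathrm{i.i.d.}}\le \mathrm{CR}_{\mathrm{i.i.d.}}\le \mathrm{CR}_{\mathrm{r.d.}}=\mathrm{CR}_{\mathrm{r.i.}}\le \overline{\mathrm{CR}}_{\mathrm{dep}}=\mathrm{CR}_{\det}=\mathrm{CR}_{\mathrm{ind}}=\mathrm{CR}_{\mathrm{dep}},\\ &\overline{\mathrm{CR}}_{\det}\le \overline{\mathrm{CR}}_{\mathrm{r.d.}}\le \overline{\mathrm{CR}}_{\mathrm{r.i.}}\le \mathrm{CR}_{\mathrm{r.i.}},\\ &\overline{\mathrm{CR}}_{\mathrm{i.i.d.}}\le \overline{\mathrm{CR}}_{\mathrm{r.i.}},\\ &\overline{\mathrm{CR}}_{\mathrm{i.i.d.}}\le \overline{\mathrm{CR}}_{\mathrm{ind}}\le \overline{\mathrm{CR}}_{\mathrm{dep}}. \end{align*}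
   Context: A request-answer game is a tuple $(R,A,f,n)$ where $R$ (requests) and $A$ (answers) are finite sets, $n$ is a positive integer, and $f:R^n\times A^n\to\mathbb{R}_{\ge 0}$ is a utility function. A deterministic online algorithm is a tuple $(g_1,\dots,g_n)$ of functions $g_i:R^i\to A$; on request sequence $\bm r=(r_1,\dots,r_n)$ it outputs $(a_1,\dots,a_n)$ with $a_i=g_i(r_1,\dots,r_i)$, and its utility is $\mathrm{ALG}(\bm r)=f(\bm r,(a_1,\dots,a_n))$. The set $\mathcal A$ of deterministic online algorithms is finite; a randomized online algorithm is a probability distribution over $\mathcal A$, its utility $\mathrm{ALG}(\bm r)$ is the expected utility of a deterministic algorithm drawn from it, and $\overline{\mathcal A}$ denotes the set of randomized online algorithms. Let $\mathrm{OPT}(\bm r)=\max_{\bm a\in A^n}f(\bm r,\bm a)$. For a set $\mathcal D$ of probability distributions on $R^n$ define $\mathrm{CR}_{\mathcal D}=\inf_{\mathrm{ALG}\in\overline{\mathcal A}}\sup_{D\in\mathcal D}\frac{\mathbb E_{\bm r\sim D}[\mathrm{OPT}(\bm r)]}{\mathbb E_{\bm r\sim D}[\mathrm{ALG}(\bm r)]}$ and $\overline{\mathrm{CR}}_{\mathcal D}=\sup_{D\in\mathcal D}\inf_{\mathrm{ALG}\in\overline{\mathcal A}}\frac{\mathbb E_{\bm r\sim D}[\mathrm{OPT}(\bm r)]}{\mathbb E_{\bm r\sim D}[\mathrm{ALG}(\bm r)]}$, with the convention $0/0=1$. For a finite set $\Omega$, $\Delta(\Omega)$ is the set of probability distributions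 on $\Omega$ and $\delta_x$ is the point mass at $x$. For a permutation $\sigma$ of $\{1,\dots,n\}$ and $\bm r\in R^n$, $\bm r^\sigma=(r_{\sigma(1)},\dots,r_{\sigma(n)})$; $\mathcal S_n$ is the set of permutations. The classes are: $\Delta_{\mathrm{dep}}(R^n)=\Delta(R^n)$; $\Delta_{\det}(R^n)=\{\delta_{\bm r}:\bm r\in R^n\}$; $\Delta_{\mathrm{ind}}(R^n)=\{D: D(\bm r)=\prod_{i=1}^n D_i(r_i),\ D_i\in\Delta(R)\}$; $\Delta_{\mathrm{i.i.d.}}(R^n)=\{D: D(\bm r)=\prod_{i=1}^n D'(r_i),\ D'\in\Delta(R)\}$; $\Delta_{\mathrm{r.d.}}(R^n)=\{\psi_{\bm r}:\bm r\in R^n\}$ where $\psi_{\bm r}(\bm r')=|\{\sigma\in\mathcal S_n:\bm r'=\bm r^\sigma\}|/n!$; $\Delta_{\mathrm{r.i.}}(R^n)=\{D: D(\bm r)=\frac1{n!}\sum_{\sigma\in\mathcal S_n}\prod_{i=1}^n D_{\sigma(i)}(r_i),\ D_i\in\Delta(R)\}$. *)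

theory Defs
  imports "HOL-Probability.Probability" "HOL-Combinatorics.Permutations" "HOL-Library.NList"
begin

text \<open>
  Sequences in \<open>X\<^sup>n\<close> are the lists in \<^term>\<open>nlists n X\<close>. List positions, and hence the
  permutations in \<open>\<S>\<^sub>n\<close> and the families \<open>D\<^sub>i\<close> of marginals, are indexed by
  \<open>{..<n}\<close> instead of \<open>{1..n}\<close>. The function \<^term>\<open>permute_list\<close> is the map
  \<open>(r, \<sigma>) \<mapsto> r\<^sup>\<sigma>\<close> (with the arguments swapped).
\<close>

locale request_answer_game =
  fixes R :: "'r set" and A :: "'a set" and f :: "'r list \<Rightarrow> 'a list \<Rightarrow> real" and n :: nat
  assumes finite_requests: "finite R"
    and finite_answers: "finite A"
    and n_pos: "n > 0"
    and utility_nonneg: "\<And>r a. r \<in> nlists n R \<Longrightarrow> a \<in> nlists n A \<Longrightarrow> f r a \<ge> 0"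


subsection \<open>Online algorithms\<close>

text \<open>
  The tuple \<open>(g\<^sub>1, \<dots>, g\<^sub>n)\<close> is a function on \<open>{1..n}\<close>; extensionality of
  \<^term>\<open>PiE\<close> makes the set of such tuples finite.
\<close>

definition det_algs :: "'r set \<Rightarrow> 'a set \<Rightarrow> nat \<Rightarrow> (nat \<Rightarrow> 'r list \<Rightarrow> 'a) set" where
  "det_algs R A n = (\<Pi>\<^sub>E i\<in>{1..n}. nlists i R \<rightarrow>\<^sub>E A)"

definition det_output :: "nat \<Rightarrow> (nat \<Rightarrow> 'r list \<Rightarrow> 'a) \<Rightarrow> 'r list \<Rightarrow> 'a list" where
  "det_output n g r = map (\<lambda>i. g i (take i r)) [1..<Suc n]"

definition Delta :: "'b set \<Rightarrow> 'b pmf set" where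
  "Delta \<Omega> = {p. set_pmf p \<subseteq> \<Omega>}"

definition rand_algs :: "'r set \<Rightarrow> 'a set \<Rightarrow> nat \<Rightarrow> (nat \<Rightarrow> 'r list \<Rightarrow> 'a) pmf set" where
  "rand_algs R A n = Delta (det_algs R A n)"

definition ALG :: "('r list \<Rightarrow> 'a list \<Rightarrow> real) \<Rightarrow> nat \<Rightarrow> (nat \<Rightarrow> 'r list \<Rightarrow> 'a) pmf \<Rightarrow> 'r list \<Rightarrow> real"
  where "ALG f n p r = measure_pmf.expectation p (\<lambda>g. f r (det_output n g r))"

definition OPT :: "'a set \<Rightarrow> ('r list \<Rightarrow> 'a list \<Rightarrow> real) \<Rightarrow> nat \<Rightarrow> 'r list \<Rightarrow> real" where
  "OPT A f n r = Max (f r ` nlists n A)"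


subsection \<open>Competitive ratios\<close>

text \<open>
  In \<^typ>\<open>ennreal\<close>, \<open>x / 0 = \<infinity>\<close> for \<open>x > 0\<close>, but \<open>0 / 0 = 0\<close>; the latter is
  overridden to be \<open>1\<close>.
\<close>

definition ratio :: "real \<Rightarrow> real \<Rightarrow> ennreal" where
  "ratio x y = (if x = 0 \<and> y = 0 then 1 else ennreal x / ennreal y)"

definition exp_ratio ::
    "'a set \<Rightarrow> ('r list \<Rightarrow> 'a list \<Rightarrow> real) \<Rightarrow> nat \<Rightarrow> (nat \<Rightarrow> 'r list \<Rightarrow> 'a) pmf \<Rightarrow> 'r list pmf \<Rightarrow> ennreal"
  where "exp_ratio A f n p D =
    ratio (measure_pmf.expectation D (OPT A f n)) (measure_pmf.expectation D (ALG f n p))"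

definition CR ::
    "'r set \<Rightarrow> 'a set \<Rightarrow> ('r list \<Rightarrow> 'a list \<Rightarrow> real) \<Rightarrow> nat \<Rightarrow> 'r list pmf set \<Rightarrow> ennreal"
  where "CR R A f n \<D> = (INF p\<in>rand_algs R A n. SUP D\<in>\<D>. exp_ratio A f n p D)"

definition CR_bar ::
    "'r set \<Rightarrow> 'a set \<Rightarrow> ('r list \<Rightarrow> 'a list \<Rightarrow> real) \<Rightarrow> nat \<Rightarrow> 'r list pmf set \<Rightarrow> ennreal"
  where "CR_bar R A f n \<D> = (SUP D\<in>\<D>. INF p\<in>rand_algs R A n. exp_ratio A f n p D)"


subsection \<open>Classes of request distributions\<close>

definition Delta_dep :: "'r set \<Rightarrow> nat \<Rightarrow> 'r list pmf set" where
  "Delta_dep R n = Delta (nlists n R)"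

definition Delta_det :: "'r set \<Rightarrow> nat \<Rightarrow> 'r list pmf set" where
  "Delta_det R n = return_pmf ` nlists n R"

definition Delta_ind :: "'r set \<Rightarrow> nat \<Rightarrow> 'r list pmf set" where
  "Delta_ind R n = {D \<in> Delta (nlists n R). \<exists>Ds. (\<forall>i<n. Ds i \<in> Delta R) \<and>
     (\<forall>r\<in>nlists n R. pmf D r = (\<Prod>i<n. pmf (Ds i) (r ! i)))}"

definition Delta_iid :: "'r set \<Rightarrow> nat \<Rightarrow> 'r list pmf set" where
  "Delta_iid R n = {D \<in> Delta (nlists n R). \<exists>D'\<in>Delta R.
     \<forall>r\<in>nlists n R. pmf D r = (\<Prod>i<n. pmf D' (r ! i))}"

definition Delta_rd :: "'r set \<Rightarrow> nat \<Rightarrow> 'r list pmf set" where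
  "Delta_rd R n = {D \<in> Delta (nlists n R). \<exists>r\<in>nlists n R. \<forall>r'\<in>nlists n R.
     pmf D r' = real (card {\<sigma>. \<sigma> permutes {..<n} \<and> r' = permute_list \<sigma> r}) / fact n}"

definition Delta_ri :: "'r set \<Rightarrow> nat \<Rightarrow> 'r list pmf set" where
  "Delta_ri R n = {D \<in> Delta (nlists n R). \<exists>Ds. (\<forall>i<n. Ds i \<in> Delta R) \<and>
     (\<forall>r\<in>nlists n R. pmf D r =
        (\<Sum>\<sigma> | \<sigma> permutes {..<n}. \<Prod>i<n. pmf (Ds (\<sigma> i)) (r ! i)) / fact n)}"

end

theory Submission
  imports Defs
begin

subsection \<open>Finitely supported distributions\<close>

text \<open>A quotient of expectations is linear neither in the algorithm nor in the distribution,
  so minimax cannot act on it directly. For a fixed real \<open>c\<close> with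
  \<open>1 \<le> c\<close>, a ratio at most \<open>c\<close> means that the expectation of
  \<open>OPT - c * ALG\<close> is at most 0; this quantity is affine in the algorithm and linear in
  the distribution. The bound \<open>1 \<le> c\<close> absorbs the convention
  \<open>0 / 0 = 1\<close>. Separation in the plane serves the single strong duality,
  \<open>CR_det_le_CR_bar_dep\<close>: there the index set is a finite set of request sequences and
  \<open>K\<close> the set of randomized algorithms. These are pmfs and not vectors, hence convexity
  of \<open>K\<close> is phrased as the existence of a \<open>z\<close> with the averaged
  values.\<close>

lemma finite_nlists:
  assumes "finite X"
  shows "finite (nlists n X)"
proof -
  have "nlists n X = {xs. set xs \<subseteq> X \<and> length xs = n}"
    unfolding nlists_def by blast
  then show ?thesis using finite_lists_length_eq[OF assms, of n] by metis
qed

lemma take_in_nlists: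
  assumes "r \<in> nlists n X" "i \<le> n"
  shows "take i r \<in> nlists i X"
proof (rule nlistsI)
  show "length (take i r) = i" using assms by simp
  show "set (take i r) \<subseteq> X"
    using nlistsE_set[OF assms(1)] by (blast dest: in_set_takeD)
qed

lemma expectation_Delta:
  fixes h :: "'b \<Rightarrow> real"
  assumes "finite \<Omega>" "D \<in> Delta \<Omega>"
  shows "measure_pmf.expectation D h = (\<Sum>x\<in>\<Omega>. h x * pmf D x)"
  using assms by (intro integral_measure_pmf_real) (auto simp: Delta_def)

lemma expectation_mono_Delta:
  fixes h k :: "'b \<Rightarrow> real"
  assumes "finite \<Omega>" "D \<in> Delta \<Omega>" "\<And>x. x \<in> \<Omega> \<Longrightarrow> h x \<le> k x"
  shows "measure_pmf.expectation D h \<le> measure_pmf.expectation D k"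
  unfolding expectation_Delta[OF assms(1,2)]
  by (intro sum_mono mult_right_mono assms(3) pmf_nonneg)

lemma expectation_diff_mult_Delta:
  fixes h k :: "'b \<Rightarrow> real"
  assumes "finite \<Omega>" "D \<in> Delta \<Omega>"
  shows "measure_pmf.expectation D (\<lambda>x. h x - c * k x) =
    measure_pmf.expectation D h - c * measure_pmf.expectation D k"
  unfolding expectation_Delta[OF assms]
  by (simp add: left_diff_distrib sum_subtractf sum_distrib_left mult.assoc)

definition mix_pmf :: "real \<Rightarrow> 'b pmf \<Rightarrow> 'b pmf \<Rightarrow> 'b pmf" where
  "mix_pmf t p q = bind_pmf (bernoulli_pmf t) (\<lambda>b. if b then p else q)"

lemma mix_pmf_in_Delta:
  assumes "p \<in> Delta \<Omega>" "q \<in> Delta \<Omega>"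
  shows "mix_pmf t p q \<in> Delta \<Omega>"
  using assms by (auto simp: mix_pmf_def Delta_def split: if_splits)

lemma expectation_mix_pmf:
  fixes h :: "'b \<Rightarrow> real"
  assumes "finite \<Omega>" "p \<in> Delta \<Omega>" "q \<in> Delta \<Omega>" "0 \<le> t" "t \<le> 1"
  shows "measure_pmf.expectation (mix_pmf t p q) h =
    t * measure_pmf.expectation p h + (1 - t) * measure_pmf.expectation q h"
proof -
  have "finite (set_pmf p)" "finite (set_pmf q)"
    using assms finite_subset by (auto simp: Delta_def)
  then show ?thesis
    using assms unfolding mix_pmf_def
    by (subst pmf_expectation_bind[where A = UNIV]) (auto simp: UNIV_bool)
qed


subsection \<open>A minimax theorem\<close>

text \<open>
  The image of \<open>K\<close> under \<open>(u, v)\<close> is a convex subset of the plane that misses the open negative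
  quadrant; the normal vector of a separating line yields the weight \<open>t\<close>.
\<close>

lemma minimax_two:
  fixes u v :: "'k \<Rightarrow> real"
  assumes convex: "\<And>x y t. x \<in> K \<Longrightarrow> y \<in> K \<Longrightarrow> 0 \<le> t \<Longrightarrow> t \<le> 1 \<Longrightarrow>
      \<exists>z\<in>K. u z = t * u x + (1 - t) * u y \<and> v z = t * v x + (1 - t) * v y"
    and nonneg: "\<And>x. x \<in> K \<Longrightarrow> 0 \<le> u x \<or> 0 \<le> v x"
  shows "\<exists>t. 0 \<le> t \<and> t \<le> 1 \<and> (\<forall>x\<in>K. 0 \<le> t * u x + (1 - t) * v x)"
proof (cases "K = {}")
  case True
  then show ?thesis by (intro exI[of _ 0]) auto
next
  case False
  define S where "S = (\<lambda>x. (u x, v x)) ` K"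
  define T where "T = {..<0::real} \<times> {..<0::real}"
  have "convex S"
  proof (rule convexI)
    fix a b :: "real \<times> real" and s t :: real
    assume "a \<in> S" "b \<in> S" and st: "0 \<le> s" "0 \<le> t" "s + t = 1"
    then obtain x y where xy: "x \<in> K" "y \<in> K" "a = (u x, v x)" "b = (u y, v y)"
      by (auto simp: S_def)
    moreover have "t = 1 - s" using st by simp
    ultimately obtain z where "z \<in> K" "u z = s * u x + t * u y" "v z = s * v x + t * v y"
      using convex[of x y s] st by auto
    then show "s *\<^sub>R a + t *\<^sub>R b \<in> S"
      using xy by (force simp: S_def)
  qed
  moreover have "convex T"
    unfolding T_def by (intro convex_Times) auto
  moreover have "S \<inter> T = {}"
    using nonneg by (fastforce simp: S_def T_def)
  moreover have "S \<noteq> {}" using False by (simp add: S_def)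
  moreover have T_mem: "(p, q) \<in> T \<longleftrightarrow> p < 0 \<and> q < 0" for p q
    by (auto simp: T_def)
  moreover have "T \<noteq> {}" using T_mem[of "-1" "-1"] by auto
  ultimately obtain a b where ab: "a \<noteq> 0" "\<forall>x\<in>T. inner a x \<le> b" "\<forall>x\<in>S. inner a x \<ge> b"
    using separating_hyperplane_sets[of T S] by (metis inf_commute)
  obtain \<alpha> \<beta> where a: "a = (\<alpha>, \<beta>)" by force
  have T: "\<alpha> * p + \<beta> * q \<le> b" if "p < 0" "q < 0" for p q
    using ab(2) that T_mem[of p q] by (force simp: a)
  have S: "b \<le> \<alpha> * u x + \<beta> * v x" if "x \<in> K" for x
    using ab(3) that by (auto simp: a S_def)
  have "\<alpha> \<ge> 0"
  \<comment> \<open>For \<alpha> < 0 the functional is unbounded above on \<open>T\<close>: the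
    first coordinate is chosen so that its term equals
    \<open>\<bar>b\<bar> + \<bar>\<beta>\<bar> + 1\<close>, which exceeds \<open>b\<close> even
    after adding \<open>- \<beta>\<close>. The argument for \<beta> is symmetric.\<close>
  proof (rule ccontr)
    assume "\<not> \<alpha> \<ge> 0"
    moreover from this have "- ((\<bar>b\<bar> + \<bar>\<beta>\<bar> + 1) / - \<alpha>) < 0"
      by (simp add: divide_pos_neg)
    ultimately show False
      using T[of "- ((\<bar>b\<bar> + \<bar>\<beta>\<bar> + 1) / - \<alpha>)" "-1"] by simp
  qed
  moreover have "\<beta> \<ge> 0"
  proof (rule ccontr)
    assume "\<not> \<beta> \<ge> 0"
    moreover from this have "- ((\<bar>b\<bar> + \<bar>\<alpha>\<bar> + 1) / - \<beta>) < 0"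
      by (simp add: divide_pos_neg)
    ultimately show False
      using T[of "-1" "- ((\<bar>b\<bar> + \<bar>\<alpha>\<bar> + 1) / - \<beta>)"] by simp
  qed
  moreover have "b \<ge> 0"
  proof (rule ccontr)
    assume b: "\<not> b \<ge> 0"
    \<comment> \<open>The origin is a limit of points of \<open>T\<close>, so \<open>b\<close>
      cannot be negative: with this \<epsilon> the value at
      \<open>(-\<epsilon>, -\<epsilon>)\<close> is at least \<open>b / 2\<close>, which is greater
      than \<open>b\<close>. The summand 1 keeps the denominator positive.\<close>
    define \<epsilon> where "\<epsilon> = - b / (2 * (\<bar>\<alpha>\<bar> + \<bar>\<beta>\<bar> + 1))"
    have "\<epsilon> > 0" unfolding \<epsilon>_def using b by (intro divide_pos_pos) auto
    have "(\<bar>\<alpha>\<bar> + \<bar>\<beta>\<bar> + 1) * \<epsilon> = - b / 2"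
      unfolding \<epsilon>_def by (simp add: field_simps add_nonneg_eq_0_iff)
    moreover have "\<alpha> * \<epsilon> + \<beta> * \<epsilon> \<le> (\<bar>\<alpha>\<bar> + \<bar>\<beta>\<bar> + 1) * \<epsilon>"
      using \<open>\<epsilon> > 0\<close> by (simp add: distrib_right[symmetric])
    ultimately show False
      using T[of "-\<epsilon>" "-\<epsilon>"] \<open>\<epsilon> > 0\<close> b by simp
  qed
  moreover have "\<alpha> \<noteq> 0 \<or> \<beta> \<noteq> 0"
    using ab(1) by (auto simp: a zero_prod_def)
  ultimately have pos: "\<alpha> + \<beta> > 0" "\<alpha> \<ge> 0" "\<beta> \<ge> 0" "b \<ge> 0" by auto
  have "0 \<le> \<alpha> / (\<alpha> + \<beta>) * u x + (1 - \<alpha> / (\<alpha> + \<beta>)) * v x" if "x \<in> K" for x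
  proof -
    have "\<alpha> / (\<alpha> + \<beta>) * u x + (1 - \<alpha> / (\<alpha> + \<beta>)) * v x = (\<alpha> * u x + \<beta> * v x) / (\<alpha> + \<beta>)"
    proof -
      have "1 - \<alpha> / (\<alpha> + \<beta>) = \<beta> / (\<alpha> + \<beta>)"
        using pos(1) by (simp add: field_simps)
      then show ?thesis by (simp add: add_divide_distrib)
    qed
    then show ?thesis using S[OF that] pos by simp
  qed
  then show ?thesis
    using pos by (intro exI[of _ "\<alpha> / (\<alpha> + \<beta>)"]) auto
qed

text \<open>
  Adding an index \<open>j\<close>: the induction hypothesis is applied to \<open>{x \<in> K. F j x < 0}\<close>, and the
  resulting average is then paired with \<open>F j\<close>.
\<close>

theorem minimax:
  fixes F :: "'i \<Rightarrow> 'k \<Rightarrow> real"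
  assumes "finite I" "I \<noteq> {}"
    and "\<And>x y t. x \<in> K \<Longrightarrow> y \<in> K \<Longrightarrow> 0 \<le> t \<Longrightarrow> t \<le> 1 \<Longrightarrow>
      \<exists>z\<in>K. \<forall>i\<in>I. F i z = t * F i x + (1 - t) * F i y"
    and "\<And>x. x \<in> K \<Longrightarrow> \<exists>i\<in>I. 0 \<le> F i x"
  shows "\<exists>D\<in>Delta I. \<forall>x\<in>K. 0 \<le> measure_pmf.expectation D (\<lambda>i. F i x)"
  using assms
proof (induction I arbitrary: K rule: finite_ne_induct)
  case (singleton i)
  then show ?case by (intro bexI[of _ "return_pmf i"]) (auto simp: Delta_def)
next
  case (insert j I)
  define K' where "K' = {x \<in> K. F j x < 0}"
  have "\<exists>D\<in>Delta I. \<forall>x\<in>K'. 0 \<le> measure_pmf.expectation D (\<lambda>i. F i x)"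
  proof (rule insert.IH)
    fix x y :: 'k and t :: real
    assume *: "x \<in> K'" "y \<in> K'" "0 \<le> t" "t \<le> 1"
    then obtain z where z: "z \<in> K" "\<forall>i\<in>insert j I. F i z = t * F i x + (1 - t) * F i y"
      using insert.prems(1)[of x y t] by (auto simp: K'_def)
    \<comment> \<open>Averaging preserves negativity of \<open>F j\<close>, so \<open>K'\<close>
      inherits the convexity hypothesis.\<close>
    have "t * F j x + (1 - t) * F j y < 0"
      using * convex_bound_lt[of "F j x" 0 "F j y" t "1 - t"] by (simp add: K'_def)
    then show "\<exists>z\<in>K'. \<forall>i\<in>I. F i z = t * F i x + (1 - t) * F i y"
      using z by (auto simp: K'_def)
  next
    \<comment> \<open>On \<open>K'\<close> the index with a nonnegative value cannot be
      \<open>j\<close>, so it lies in \<open>I\<close>.\<close>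
    fix x assume "x \<in> K'"
    then show "\<exists>i\<in>I. 0 \<le> F i x"
      using insert.prems(2)[of x] by (auto simp: K'_def)
  qed
  then obtain D where D: "D \<in> Delta I" "\<forall>x\<in>K'. 0 \<le> measure_pmf.expectation D (\<lambda>i. F i x)"
    by blast
  define u where "u x = measure_pmf.expectation D (\<lambda>i. F i x)" for x
  have "\<exists>t. 0 \<le> t \<and> t \<le> 1 \<and> (\<forall>x\<in>K. 0 \<le> t * u x + (1 - t) * F j x)"
  proof (rule minimax_two)
    fix x y :: 'k and t :: real
    assume "x \<in> K" "y \<in> K" "0 \<le> t" "t \<le> 1"
    then obtain z where z: "z \<in> K" "\<forall>i\<in>insert j I. F i z = t * F i x + (1 - t) * F i y"
      using insert.prems(1)[of x y t] by auto
    have "u z = (\<Sum>i\<in>I. (t * F i x + (1 - t) * F i y) * pmf D i)"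
      unfolding u_def expectation_Delta[OF \<open>finite I\<close> D(1)] using z(2) by simp
    also have "\<dots> = t * u x + (1 - t) * u y"
      unfolding u_def expectation_Delta[OF \<open>finite I\<close> D(1)]
      by (simp add: sum_distrib_left distrib_right mult.assoc flip: sum.distrib)
    finally have "u z = t * u x + (1 - t) * u y" .
    then show "\<exists>z\<in>K. u z = t * u x + (1 - t) * u y \<and> F j z = t * F j x + (1 - t) * F j y"
      using z by auto
  next
    fix x assume "x \<in> K"
    then show "0 \<le> u x \<or> 0 \<le> F j x"
      using D(2) by (auto simp: u_def K'_def not_less[symmetric])
  qed
  then obtain t where t: "0 \<le> t" "t \<le> 1" "\<forall>x\<in>K. 0 \<le> t * u x + (1 - t) * F j x"
    by blast
  have D': "D \<in> Delta (insert j I)" "return_pmf j \<in> Delta (insert j I)"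
    using D(1) by (auto simp: Delta_def)
  show ?case
  proof (intro bexI ballI)
    show "mix_pmf t D (return_pmf j) \<in> Delta (insert j I)"
      using D' by (rule mix_pmf_in_Delta)
    show "0 \<le> measure_pmf.expectation (mix_pmf t D (return_pmf j)) (\<lambda>i. F i x)" if "x \<in> K" for x
      using t that insert.hyps by (subst expectation_mix_pmf[OF _ D']) (auto simp: u_def)
  qed
qed


subsection \<open>Inclusions between the classes\<close>

lemma Delta_ind_subset_dep: "Delta_ind R n \<subseteq> Delta_dep R n"
  by (auto simp: Delta_ind_def Delta_dep_def)

lemma Delta_ri_subset_dep: "Delta_ri R n \<subseteq> Delta_dep R n"
  by (auto simp: Delta_ri_def Delta_dep_def)

lemma Delta_iid_subset_ind: "Delta_iid R n \<subseteq> Delta_ind R n"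
  by (fastforce simp: Delta_iid_def Delta_ind_def)

text \<open>For a constant family of marginals all summands coincide, and their number cancels
  \<open>fact n\<close>.\<close>

lemma Delta_iid_subset_ri: "Delta_iid R n \<subseteq> Delta_ri R n"
proof
  fix D assume "D \<in> Delta_iid R n"
  then obtain D' where D: "D \<in> Delta (nlists n R)" "D' \<in> Delta R"
    "\<And>r. r \<in> nlists n R \<Longrightarrow> pmf D r = (\<Prod>i<n. pmf D' (r ! i))"
    by (auto simp: Delta_iid_def)
  have "card {\<sigma>. \<sigma> permutes {..<n}} = fact n"
    by (rule card_permutations) auto
  with D show "D \<in> Delta_ri R n"
    by (auto simp: Delta_ri_def intro!: exI[of _ "\<lambda>_. D'"])
qed

text \<open>With point masses as truth values, a product of them becomes the truth value of the
  entrywise equality of two lists.\<close>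

lemma pmf_return_of_bool: "pmf (return_pmf x) y = of_bool (y = x)"
  by (simp add: indicator_def)

lemma prod_of_bool:
  assumes "finite I"
  shows "(\<Prod>i\<in>I. of_bool (P i) :: real) = of_bool (\<forall>i\<in>I. P i)"
  using assms by (induction rule: finite_induct) auto

text \<open>A point mass on lists is the product of the point masses at its entries.\<close>

lemma Delta_det_subset_ind: "Delta_det R n \<subseteq> Delta_ind R n"
proof
  fix D assume "D \<in> Delta_det R n"
  then obtain r where r: "r \<in> nlists n R" "D = return_pmf r"
    by (auto simp: Delta_det_def)
  have "pmf D r' = (\<Prod>i<n. pmf (return_pmf (r ! i)) (r' ! i))" if "r' \<in> nlists n R" for r'
    using r that
    by (simp add: pmf_return_of_bool prod_of_bool list_eq_iff_nth_eq Ball_def del: pmf_return)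
  moreover have "\<forall>i<n. return_pmf (r ! i) \<in> Delta R"
    using r by (auto simp: Delta_def nlistsE_nth_in)
  ultimately show "D \<in> Delta_ind R n"
    using r by (auto simp: Delta_ind_def Delta_def intro!: exI[of _ "\<lambda>i. return_pmf (r ! i)"])
qed

text \<open>Take the point masses at the entries of \<open>r\<close> as marginals. The summand for
  \<sigma> is then 1 or 0 according to whether \<sigma> carries \<open>r\<close> to
  \<open>r'\<close>, so the sum counts permutations.\<close>

lemma Delta_rd_subset_ri: "Delta_rd R n \<subseteq> Delta_ri R n"
proof
  fix D assume "D \<in> Delta_rd R n"
  then obtain r where D: "D \<in> Delta (nlists n R)" and r: "r \<in> nlists n R"
    and pmf_D: "\<And>r'. r' \<in> nlists n R \<Longrightarrow>
      pmf D r' = real (card {\<sigma>. \<sigma> permutes {..<n} \<and> r' = permute_list \<sigma> r}) / fact n"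
    by (auto simp: Delta_rd_def)
  have "real (card {\<sigma>. \<sigma> permutes {..<n} \<and> r' = permute_list \<sigma> r}) =
      (\<Sum>\<sigma> | \<sigma> permutes {..<n}. \<Prod>i<n. pmf (return_pmf (r ! \<sigma> i)) (r' ! i))"
    if r': "r' \<in> nlists n R" for r'
  proof -
    have "(\<Prod>i<n. pmf (return_pmf (r ! \<sigma> i)) (r' ! i)) = of_bool (r' = permute_list \<sigma> r)"
      if "\<sigma> permutes {..<n}" for \<sigma>
      using that r r'
      by (simp add: pmf_return_of_bool prod_of_bool list_eq_iff_nth_eq permute_list_nth Ball_def
          del: pmf_return)
    then have "(\<Sum>\<sigma> | \<sigma> permutes {..<n}. \<Prod>i<n. pmf (return_pmf (r ! \<sigma> i)) (r' ! i)) =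
        (\<Sum>\<sigma> | \<sigma> permutes {..<n}. of_bool (r' = permute_list \<sigma> r))"
      by (intro sum.cong) auto
    also have "\<dots> = real (card ({\<sigma>. \<sigma> permutes {..<n}} \<inter> {\<sigma>. r' = permute_list \<sigma> r}))"
      by (rule sum_of_bool_eq) (simp_all add: finite_permutations)
    finally show ?thesis
      by (simp add: Collect_conj_eq)
  qed
  moreover have "\<forall>i<n. return_pmf (r ! i) \<in> Delta R"
    using r by (auto simp: Delta_def nlistsE_nth_in)
  ultimately show "D \<in> Delta_ri R n"
    using D pmf_D by (auto simp: Delta_ri_def intro!: exI[of _ "\<lambda>i. return_pmf (r ! i)"])
qed

text \<open>Provides a member of the i.i.d. class, which \<open>CR_bar_det_le\<close> requires to be
  nonempty.\<close>

lemma return_replicate_in_Delta_iid: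
  assumes "x \<in> R"
  shows "return_pmf (replicate n x) \<in> Delta_iid R n"
proof -
  have "pmf (return_pmf (replicate n x)) r = (\<Prod>i<n. pmf (return_pmf x) (r ! i))"
    if "r \<in> nlists n R" for r
    using that
    by (simp add: pmf_return_of_bool prod_of_bool list_eq_iff_nth_eq Ball_def del: pmf_return)
  then show ?thesis
    using assms unfolding Delta_iid_def Delta_def mem_Collect_eq
    by (intro conjI bexI[of _ "return_pmf x"]) auto
qed


subsection \<open>Random order\<close>

text \<open>This is \<psi> of \<open>r\<close>. The class \<open>Delta_rd\<close> only constrains
  mass functions; the explicit pmf shows that each such constraint is met.\<close>

definition shuffle_pmf :: "nat \<Rightarrow> 'r list \<Rightarrow> 'r list pmf" where
  "shuffle_pmf n r = map_pmf (\<lambda>\<sigma>. permute_list \<sigma> r) (pmf_of_set {\<sigma>. \<sigma> permutes {..<n}})"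

lemma permutations_finite_nonempty:
  "finite {\<sigma>. \<sigma> permutes {..<n::nat}}" "{\<sigma>. \<sigma> permutes {..<n::nat}} \<noteq> {}"
  using permutes_id[of "{..<n}"] by (auto simp: finite_permutations simp del: permutes_id)

lemma permute_list_in_nlists:
  assumes "r \<in> nlists n R" "\<sigma> permutes {..<n}"
  shows "permute_list \<sigma> r \<in> nlists n R"
  using assms nlistsE_set[OF assms(1)] by (intro nlistsI) auto

lemma shuffle_pmf_in_Delta_rd:
  assumes "r \<in> nlists n R"
  shows "shuffle_pmf n r \<in> Delta_rd R n"
proof -
  have "shuffle_pmf n r \<in> Delta (nlists n R)"
    using permutations_finite_nonempty assms
    by (auto simp: shuffle_pmf_def Delta_def permute_list_in_nlists)
  moreover have "pmf (shuffle_pmf n r) r' =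
      real (card {\<sigma>. \<sigma> permutes {..<n} \<and> r' = permute_list \<sigma> r}) / fact n" for r'
  proof -
    have "{\<sigma>. \<sigma> permutes {..<n}} \<inter> (\<lambda>\<sigma>. permute_list \<sigma> r) -` {r'} =
        {\<sigma>. \<sigma> permutes {..<n} \<and> r' = permute_list \<sigma> r}"
      by blast
    then show ?thesis
      using permutations_finite_nonempty[of n] card_permutations[OF refl, of "{..<n}"]
      by (simp add: shuffle_pmf_def pmf_map measure_pmf_of_set)
  qed
  ultimately show ?thesis
    using assms by (auto simp: Delta_rd_def)
qed

lemma expectation_shuffle_pmf:
  fixes h :: "'r list \<Rightarrow> real"
  shows "measure_pmf.expectation (shuffle_pmf n r) h =
    (\<Sum>\<sigma> | \<sigma> permutes {..<n}. h (permute_list \<sigma> r)) / fact n"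
  using permutations_finite_nonempty[of n] card_permutations[OF refl, of "{..<n}"]
  by (simp add: shuffle_pmf_def integral_pmf_of_set)

lemma bij_betw_permute_list:
  assumes "\<sigma> permutes {..<n}"
  shows "bij_betw (permute_list \<sigma>) (nlists n R) (nlists n R)"
proof (rule bij_betw_byWitness[where f' = "permute_list (inv \<sigma>)"])
  have inv: "inv \<sigma> permutes {..<n}" using assms by (rule permutes_inv)
  show "\<forall>r\<in>nlists n R. permute_list (inv \<sigma>) (permute_list \<sigma> r) = r"
    using inv permutes_inv_o(1)[OF assms] by (simp flip: permute_list_compose)
  show "\<forall>r\<in>nlists n R. permute_list \<sigma> (permute_list (inv \<sigma>) r) = r"
    using assms permutes_inv_o(2)[OF assms] by (simp flip: permute_list_compose)
  show "permute_list \<sigma> ` nlists n R \<subseteq> nlists n R"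
    using assms by (auto simp: permute_list_in_nlists)
  show "permute_list (inv \<sigma>) ` nlists n R \<subseteq> nlists n R"
    using inv by (auto simp: permute_list_in_nlists)
qed

text \<open>A member of \<open>Delta_ri\<close> arises by drawing \<open>r\<close> from the product
  of the \<open>Ds i\<close> and then shuffling it. Substituting
  \<open>permute_list \<sigma> r\<close> for \<open>r\<close> in the summand of \<sigma> turns
  \<open>Ds (\<sigma> i)\<close> back into \<open>Ds i\<close> and moves \<sigma> into the argument
  of \<open>h\<close>.\<close>

lemma expectation_ri:
  fixes h :: "'r list \<Rightarrow> real"
  assumes "finite R" "D \<in> Delta (nlists n R)"
    and pmf_D: "\<forall>r\<in>nlists n R.
      pmf D r = (\<Sum>\<sigma> | \<sigma> permutes {..<n}. \<Prod>i<n. pmf (Ds (\<sigma> i)) (r ! i)) / fact n"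
  shows "measure_pmf.expectation D h =
    (\<Sum>r\<in>nlists n R. (\<Prod>i<n. pmf (Ds i) (r ! i)) * measure_pmf.expectation (shuffle_pmf n r) h)"
proof -
  let ?N = "nlists n R" and ?P = "{\<sigma>. \<sigma> permutes {..<n}}"
  have "(\<Sum>r\<in>?N. h r * (\<Prod>i<n. pmf (Ds (\<sigma> i)) (r ! i))) =
      (\<Sum>r\<in>?N. h (permute_list \<sigma> r) * (\<Prod>i<n. pmf (Ds i) (r ! i)))" if \<sigma>: "\<sigma> \<in> ?P" for \<sigma>
  proof -
    have "(\<Prod>i<n. pmf (Ds (\<sigma> i)) (permute_list \<sigma> r ! i)) = (\<Prod>i<n. pmf (Ds i) (r ! i))"
      if "r \<in> ?N" for r
    proof -
      have "(\<Prod>i<n. pmf (Ds (\<sigma> i)) (permute_list \<sigma> r ! i)) = (\<Prod>i<n. pmf (Ds (\<sigma> i)) (r ! \<sigma> i))"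
        using \<sigma> nlistsE_length[OF that] by (intro prod.cong) (auto simp: permute_list_nth)
      also have "\<dots> = (\<Prod>i<n. pmf (Ds i) (r ! i))"
        using \<sigma> prod.permute[of \<sigma> "{..<n}" "\<lambda>i. pmf (Ds i) (r ! i)"] by (simp add: o_def)
      finally show ?thesis .
    qed
    moreover have "bij_betw (permute_list \<sigma>) ?N ?N"
      using \<sigma> by (auto intro: bij_betw_permute_list)
    ultimately show ?thesis
      by (subst sum.reindex_bij_betw[symmetric]) auto
  qed
  then have "(\<Sum>\<sigma>\<in>?P. \<Sum>r\<in>?N. h r * (\<Prod>i<n. pmf (Ds (\<sigma> i)) (r ! i))) =
      (\<Sum>\<sigma>\<in>?P. \<Sum>r\<in>?N. h (permute_list \<sigma> r) * (\<Prod>i<n. pmf (Ds i) (r ! i)))"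
    by (rule sum.cong[OF refl])
  then have "(\<Sum>r\<in>?N. \<Sum>\<sigma>\<in>?P. h r * (\<Prod>i<n. pmf (Ds (\<sigma> i)) (r ! i))) =
      (\<Sum>r\<in>?N. \<Sum>\<sigma>\<in>?P. h (permute_list \<sigma> r) * (\<Prod>i<n. pmf (Ds i) (r ! i)))"
    by (subst (1 2) sum.swap)
  then show ?thesis
    using pmf_D unfolding expectation_Delta[OF finite_nlists[OF assms(1)] assms(2)]
    by (simp add: expectation_shuffle_pmf sum_distrib_left sum_distrib_right mult.commute
        flip: sum_divide_distrib)
qed


subsection \<open>Competitive ratios\<close>

lemma CR_bar_le_CR: "CR_bar R A f n \<D> \<le> CR R A f n \<D>"
  unfolding CR_def CR_bar_def
  by (intro SUP_least INF_greatest) (meson INF_lower SUP_upper order_trans)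

lemma CR_mono: "\<D> \<subseteq> \<D>' \<Longrightarrow> CR R A f n \<D> \<le> CR R A f n \<D>'"
  unfolding CR_def by (intro INF_mono') (rule SUP_subset_mono, auto)

lemma CR_bar_mono: "\<D> \<subseteq> \<D>' \<Longrightarrow> CR_bar R A f n \<D> \<le> CR_bar R A f n \<D>'"
  unfolding CR_bar_def by (rule SUP_subset_mono) auto

section \<open>Comparing a ratio with a constant under \<open>0 / 0 = 1\<close>\<close>

lemma ratio_ge_1:
  assumes "0 \<le> y" "y \<le> x"
  shows "1 \<le> ratio x y"
proof (cases "y = 0")
  case True
  with assms show ?thesis by (auto simp: ratio_def)
next
  case False
  with assms have "ratio x y = ennreal (x / y)"
    by (simp add: ratio_def divide_ennreal)
  then show ?thesis using False assms by simp
qed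

text \<open>If \<open>y = 0 < x\<close>, the ratio is infinite and both sides fail. If
  \<open>x = y = 0\<close>, the right side holds, and the left one reads \<open>1 \<le> c\<close>;
  hence the hypothesis on \<open>c\<close>.\<close>

lemma ratio_le_iff:
  assumes "0 \<le> x" "0 \<le> y" "1 \<le> c"
  shows "ratio x y \<le> ennreal c \<longleftrightarrow> x \<le> c * y"
proof (cases "y = 0")
  case True
  with assms show ?thesis by (auto simp: ratio_def top_unique)
next
  case False
  with assms have "ratio x y = ennreal (x / y)"
    by (simp add: ratio_def divide_ennreal)
  then show ?thesis using False assms by (simp add: field_simps)
qed

text \<open>The hypothesis \<open>0 < x\<close> rules out \<open>0 / 0\<close>, where
  \<open>c * y \<le> x\<close> holds for every \<open>c\<close> although the ratio is only
  1.\<close>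

lemma le_ratio:
  assumes "0 < x" "0 \<le> y" "0 \<le> c" "c * y \<le> x"
  shows "ennreal c \<le> ratio x y"
proof (cases "y = 0")
  case True
  with assms show ?thesis by (auto simp: ratio_def)
next
  case False
  with assms have "ratio x y = ennreal (x / y)"
    by (simp add: ratio_def divide_ennreal)
  then show ?thesis using False assms by (simp add: field_simps)
qed

text \<open>Without answers there is no algorithm and \<open>OPT\<close> is a maximum over the empty
  set; without requests all classes are empty. Both cases are settled separately in
  \<open>theorem1\<close>. In the statements of this locale \<open>'a\<close> is the type of
  requests.\<close>

locale nonempty_request_answer_game = request_answer_game +
  assumes R_nonempty: "R \<noteq> {}" and A_nonempty: "A \<noteq> {}"
begin

section \<open>Nonempty games: bounds on the expected ratio and its linearisation\<close>

lemma finite_request_lists: "finite (nlists n R)"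
  using finite_requests by (rule finite_nlists)

lemma finite_answer_lists: "finite (nlists n A)"
  using finite_answers by (rule finite_nlists)

lemma finite_det_algs: "finite (det_algs R A n)"
  unfolding det_algs_def
  by (intro finite_PiE finite_nlists finite_requests finite_answers) auto

lemma det_output_in_nlists:
  assumes "g \<in> det_algs R A n" "r \<in> nlists n R"
  shows "det_output n g r \<in> nlists n A"
proof (rule nlistsI)
  show "length (det_output n g r) = n" by (simp add: det_output_def)
  have "g i (take i r) \<in> A" if "1 \<le> i" "i \<le> n" for i
  proof -
    have "take i r \<in> nlists i R"
      using assms(2) \<open>i \<le> n\<close> by (rule take_in_nlists)
    moreover have "g i \<in> nlists i R \<rightarrow>\<^sub>E A"
      using assms(1) that unfolding det_algs_def by (intro PiE_mem[of g]) auto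
    ultimately show ?thesis by (rule PiE_mem[rotated])
  qed
  then show "set (det_output n g r) \<subseteq> A" by (auto simp: det_output_def)
qed

lemma det_algs_output:
  assumes "r \<in> nlists n R" "a \<in> nlists n A"
  shows "\<exists>g\<in>det_algs R A n. det_output n g r = a"
proof
  \<comment> \<open>This algorithm ignores the requests and plays \<open>a\<close>. Rounds count
    from 1 and list positions from 0, hence \<open>i - 1\<close>; the restrictions supply the
    extensionality that \<open>PiE\<close> demands.\<close>
  define g where "g = (\<lambda>i\<in>{1..n}. \<lambda>s\<in>nlists i R. a ! (i - 1))"
  show "g \<in> det_algs R A n"
    using assms(2) by (auto simp: g_def det_algs_def intro!: nlistsE_nth_in[of _ n])
  show "det_output n g r = a"
  proof (rule nth_equalityI)
    show "length (det_output n g r) = length a"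
      using assms(2) by (simp add: det_output_def)
    fix i assume "i < length (det_output n g r)"
    then have "i < n" by (simp add: det_output_def del: upt_Suc)
    moreover have "take (Suc i) r \<in> nlists (Suc i) R"
      using \<open>i < n\<close> by (intro take_in_nlists[OF assms(1)]) simp
    ultimately show "det_output n g r ! i = a ! i"
      by (simp add: det_output_def g_def del: upt_Suc)
  qed
qed

lemma OPT_attained:
  assumes "r \<in> nlists n R"
  shows "\<exists>g\<in>det_algs R A n. f r (det_output n g r) = OPT A f n r"
proof -
  have "f r ` nlists n A \<noteq> {}"
    using nlists_not_empty[OF A_nonempty] by auto
  then have "OPT A f n r \<in> f r ` nlists n A"
    unfolding OPT_def using finite_answer_lists by (intro Max_in) auto
  then show ?thesis
    using det_algs_output[OF assms] by force
qed

lemma utility_le_OPT: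
  assumes "a \<in> nlists n A"
  shows "f r a \<le> OPT A f n r"
  unfolding OPT_def using assms finite_answer_lists by (intro Max_ge) auto

lemma ALG_bounds:
  assumes "p \<in> rand_algs R A n" "r \<in> nlists n R"
  shows "0 \<le> ALG f n p r" "ALG f n p r \<le> OPT A f n r"
proof -
  have *: "0 \<le> f r (det_output n g r)" "f r (det_output n g r) \<le> OPT A f n r"
    if "g \<in> det_algs R A n" for g
    using that assms(2) by (auto intro: utility_nonneg utility_le_OPT det_output_in_nlists)
  note mono = expectation_mono_Delta[OF finite_det_algs assms(1)[unfolded rand_algs_def]]
  show "0 \<le> ALG f n p r"
    using mono[of "\<lambda>_. 0" "\<lambda>g. f r (det_output n g r)"] * by (simp add: ALG_def)
  show "ALG f n p r \<le> OPT A f n r"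
    using mono[of "\<lambda>g. f r (det_output n g r)" "\<lambda>_. OPT A f n r"] * by (simp add: ALG_def)
qed

lemma expectation_ALG_bounds:
  assumes "p \<in> rand_algs R A n" "D \<in> Delta (nlists n R)"
  shows "0 \<le> measure_pmf.expectation D (ALG f n p)"
    and "measure_pmf.expectation D (ALG f n p) \<le> measure_pmf.expectation D (OPT A f n)"
  using expectation_mono_Delta[OF finite_request_lists assms(2), of "\<lambda>_. 0" "ALG f n p"]
    expectation_mono_Delta[OF finite_request_lists assms(2), of "ALG f n p" "OPT A f n"]
    ALG_bounds[OF assms(1)] by simp_all

lemma exp_ratio_ge_1:
  assumes "p \<in> rand_algs R A n" "D \<in> Delta (nlists n R)"
  shows "1 \<le> exp_ratio A f n p D"
  unfolding exp_ratio_def using expectation_ALG_bounds[OF assms] by (rule ratio_ge_1)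

lemma exp_ratio_le_iff:
  assumes "p \<in> rand_algs R A n" "D \<in> Delta (nlists n R)" "1 \<le> c"
  shows "exp_ratio A f n p D \<le> ennreal c \<longleftrightarrow>
    measure_pmf.expectation D (\<lambda>r. OPT A f n r - c * ALG f n p r) \<le> 0"
proof -
  have "exp_ratio A f n p D \<le> ennreal c \<longleftrightarrow>
      measure_pmf.expectation D (OPT A f n) \<le> c * measure_pmf.expectation D (ALG f n p)"
    unfolding exp_ratio_def
    using expectation_ALG_bounds[OF assms(1,2)] assms(3) by (intro ratio_le_iff) auto
  then show ?thesis
    by (simp add: expectation_diff_mult_Delta[OF finite_request_lists assms(2)])
qed

text \<open>
  By \<open>exp_ratio_le_iff\<close>, being \<open>c\<close>-competitive is a linear condition on the distribution, so it
  passes from a class to all of its mixtures.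
\<close>

lemma CR_mixture_le:
  assumes "\<D> \<subseteq> Delta (nlists n R)" "\<D>' \<subseteq> Delta (nlists n R)" "\<D>' \<noteq> {}"
    and mixture: "\<And>(h :: 'a list \<Rightarrow> real) D.
      \<lbrakk>\<And>D'. D' \<in> \<D>' \<Longrightarrow> measure_pmf.expectation D' h \<le> 0; D \<in> \<D>\<rbrakk> \<Longrightarrow>
      measure_pmf.expectation D h \<le> 0"
  shows "CR R A f n \<D> \<le> CR R A f n \<D>'"
  unfolding CR_def
proof (intro INF_superset_mono[OF order_refl] SUP_least)
  fix p D assume p: "p \<in> rand_algs R A n" and D: "D \<in> \<D>"
  define s where "s = (SUP D'\<in>\<D>'. exp_ratio A f n p D')"
  have upper: "exp_ratio A f n p D' \<le> s" if "D' \<in> \<D>'" for D'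
    unfolding s_def using that by (rule SUP_upper)
  \<comment> \<open>A single member of \<open>\<D>'\<close> already forces \<open>1 \<le> s\<close>,
    which puts a finite \<open>s\<close> in the range where \<open>exp_ratio_le_iff\<close>
    applies.\<close>
  obtain D0 where D0: "D0 \<in> \<D>'" using assms(3) by auto
  then have "1 \<le> s"
    using upper[OF D0] exp_ratio_ge_1[OF p, of D0] assms(2) by auto
  have "exp_ratio A f n p D \<le> s"
  proof (cases s rule: ennreal_cases)
    case (real c)
    then have c: "1 \<le> c" using \<open>1 \<le> s\<close> by simp
    have "measure_pmf.expectation D' (\<lambda>r. OPT A f n r - c * ALG f n p r) \<le> 0" if "D' \<in> \<D>'" for D'
      using upper[OF that] exp_ratio_le_iff[OF p _ c, of D'] that assms(2) by (auto simp: real)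
    then have "measure_pmf.expectation D (\<lambda>r. OPT A f n r - c * ALG f n p r) \<le> 0"
      using D by (rule mixture)
    then show ?thesis
      using exp_ratio_le_iff[OF p _ c, of D] D assms(1) by (auto simp: real)
  qed auto
  then show "exp_ratio A f n p D \<le> (SUP D'\<in>\<D>'. exp_ratio A f n p D')"
    by (simp add: s_def)
qed

text \<open>Every distribution is a mixture of point masses: a function that is nonpositive at each
  sequence has a nonpositive mean.\<close>

lemma CR_dep_le_det: "CR R A f n (Delta_dep R n) \<le> CR R A f n (Delta_det R n)"
proof (rule CR_mixture_le)
  show "Delta_det R n \<noteq> {}"
    using nlists_not_empty[OF R_nonempty] by (auto simp: Delta_det_def)
  show "Delta_det R n \<subseteq> Delta (nlists n R)"
    by (auto simp: Delta_det_def Delta_def)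
  fix h :: "'a list \<Rightarrow> real" and D
  assume *: "\<And>D'. D' \<in> Delta_det R n \<Longrightarrow> measure_pmf.expectation D' h \<le> 0"
    and D: "D \<in> Delta_dep R n"
  have "h r \<le> 0" if "r \<in> nlists n R" for r
    using *[of "return_pmf r"] that by (simp add: Delta_det_def)
  then show "measure_pmf.expectation D h \<le> 0"
    using expectation_mono_Delta[OF finite_request_lists, of D h "\<lambda>_. 0"] D
    by (simp add: Delta_dep_def)
qed (auto simp: Delta_dep_def)

text \<open>By \<open>expectation_ri\<close>, members of \<open>Delta_ri\<close> are mixtures of
  shuffles, with nonnegative product weights.\<close>

lemma CR_ri_le_rd: "CR R A f n (Delta_ri R n) \<le> CR R A f n (Delta_rd R n)"
proof (rule CR_mixture_le)
  show "Delta_rd R n \<noteq> {}"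
    using nlists_not_empty[OF R_nonempty, of n] shuffle_pmf_in_Delta_rd[of _ n R] by auto
  fix h :: "'a list \<Rightarrow> real" and D
  assume *: "\<And>D'. D' \<in> Delta_rd R n \<Longrightarrow> measure_pmf.expectation D' h \<le> 0"
    and "D \<in> Delta_ri R n"
  then obtain Ds where "D \<in> Delta (nlists n R)" "\<forall>r\<in>nlists n R.
      pmf D r = (\<Sum>\<sigma> | \<sigma> permutes {..<n}. \<Prod>i<n. pmf (Ds (\<sigma> i)) (r ! i)) / fact n"
    by (auto simp: Delta_ri_def)
  note expectation_ri[OF finite_requests this, of h]
  also have "(\<Sum>r\<in>nlists n R.
      (\<Prod>i<n. pmf (Ds i) (r ! i)) * measure_pmf.expectation (shuffle_pmf n r) h) \<le> 0"
    by (intro sum_nonpos mult_nonneg_nonpos prod_nonneg * shuffle_pmf_in_Delta_rd)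
      (auto simp: pmf_nonneg)
  finally show "measure_pmf.expectation D h \<le> 0" .
qed (auto simp: Delta_ri_def Delta_rd_def)

text \<open>The value 1 separates the two sides. Against a known point mass the optimal answers can
  be hard-coded, giving ratio at most 1; no algorithm has a ratio below 1 against any
  distribution.\<close>

lemma CR_bar_det_le:
  assumes "\<D> \<subseteq> Delta (nlists n R)" "\<D> \<noteq> {}"
  shows "CR_bar R A f n (Delta_det R n) \<le> CR_bar R A f n \<D>"
proof -
  have "CR_bar R A f n (Delta_det R n) \<le> 1"
    unfolding CR_bar_def
  proof (rule SUP_least)
    fix D assume "D \<in> Delta_det R n"
    then obtain r where r: "r \<in> nlists n R" "D = return_pmf r"
      by (auto simp: Delta_det_def)
    obtain g where g: "g \<in> det_algs R A n" "f r (det_output n g r) = OPT A f n r"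
      using OPT_attained[OF r(1)] by blast
    have p: "return_pmf g \<in> rand_algs R A n"
      using g(1) by (simp add: rand_algs_def Delta_def)
    have "D \<in> Delta (nlists n R)" using r by (simp add: Delta_def)
    then have "exp_ratio A f n (return_pmf g) D \<le> ennreal 1"
      using g r by (subst exp_ratio_le_iff[OF p]) (auto simp: ALG_def)
    with p show "(INF p\<in>rand_algs R A n. exp_ratio A f n p D) \<le> 1"
      by (auto intro: INF_lower2)
  qed
  also obtain D where D: "D \<in> \<D>" using assms(2) by auto
  then have "1 \<le> (INF p\<in>rand_algs R A n. exp_ratio A f n p D)"
    using assms(1) by (intro INF_greatest exp_ratio_ge_1) auto
  also have "\<dots> \<le> CR_bar R A f n \<D>"
    unfolding CR_bar_def using D by (rule SUP_upper)
  finally show ?thesis .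
qed

text \<open>
  The adversary may be restricted to sequences with positive optimum, since on the others every
  algorithm is optimal. This excludes the ratio \<open>0 / 0\<close>.
\<close>

lemma CR_det_le_CR_bar_dep: "CR R A f n (Delta_det R n) \<le> CR_bar R A f n (Delta_dep R n)"
\<comment> \<open>Strictly below the infimum, every algorithm is beaten at some sequence by a strict
  inequality, and \<open>s\<close> is finite even if the competitive ratio is infinite.\<close>
proof (rule dense_le)
  fix s assume s: "s < CR R A f n (Delta_det R n)"
  show "s \<le> CR_bar R A f n (Delta_dep R n)"
  proof (cases "s \<le> 1")
    case True
    obtain r where "r \<in> nlists n R" using nlists_not_empty[OF R_nonempty] by auto
    then have "return_pmf r \<in> Delta_dep R n" by (simp add: Delta_dep_def Delta_def)
    have "1 \<le> (INF p\<in>rand_algs R A n. exp_ratio A f n p (return_pmf r))"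
      using \<open>r \<in> nlists n R\<close> by (intro INF_greatest exp_ratio_ge_1) (auto simp: Delta_def)
    also have "\<dots> \<le> CR_bar R A f n (Delta_dep R n)"
      unfolding CR_bar_def using \<open>return_pmf r \<in> _\<close> by (rule SUP_upper)
    finally show ?thesis using True by simp
  next
    case False
    moreover have "s < top" using s top.not_eq_extremum by fastforce
    ultimately obtain c where c: "1 \<le> c" "s = ennreal c"
      by (cases s rule: ennreal_cases) auto
    define I where "I = {r \<in> nlists n R. 0 < OPT A f n r}"
    define F where "F r p = OPT A f n r - c * ALG f n p r" for r p
    \<comment> \<open>\<open>0 < F r p\<close> says that \<open>p\<close> fails to be
      \<open>c\<close>-competitive at \<open>r\<close>. As \<open>c * ALG f n p r\<close> is
      nonnegative, it also forces a positive optimum, so \<open>r\<close> lies in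
      \<open>I\<close>.\<close>
    have bad: "\<exists>r\<in>I. 0 < F r p" if p: "p \<in> rand_algs R A n" for p
    proof -
      have "s < (SUP D\<in>Delta_det R n. exp_ratio A f n p D)"
        using s p unfolding CR_def by (auto intro: less_le_trans INF_lower)
      then obtain r where r: "r \<in> nlists n R" "s < exp_ratio A f n p (return_pmf r)"
        by (auto simp: less_SUP_iff Delta_det_def)
      then have "0 < F r p"
        using exp_ratio_le_iff[OF p _ c(1), of "return_pmf r"]
        by (auto simp: c(2) F_def Delta_def not_le[symmetric])
      moreover have "0 \<le> c * ALG f n p r"
        using ALG_bounds(1)[OF p r(1)] c(1) by simp
      ultimately show ?thesis
        using r(1) by (intro bexI[of _ r]) (auto simp: F_def I_def)
    qed
    obtain r0 g0 where "r0 \<in> nlists n R" "g0 \<in> det_algs R A n"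
      using nlists_not_empty[OF R_nonempty] OPT_attained by metis
    then have "return_pmf g0 \<in> rand_algs R A n"
      by (simp add: rand_algs_def Delta_def)
    from bad[OF this] have "I \<noteq> {}" by auto
    have "finite I" using finite_request_lists by (simp add: I_def)
    have "\<exists>D\<in>Delta I. \<forall>p\<in>rand_algs R A n. 0 \<le> measure_pmf.expectation D (\<lambda>r. F r p)"
      using \<open>finite I\<close> \<open>I \<noteq> {}\<close>
    proof (rule minimax)
      fix p q and t :: real
      assume *: "p \<in> rand_algs R A n" "q \<in> rand_algs R A n" "0 \<le> t" "t \<le> 1"
      then have pq: "p \<in> Delta (det_algs R A n)" "q \<in> Delta (det_algs R A n)"
        by (simp_all add: rand_algs_def)
      have "F r (mix_pmf t p q) = t * F r p + (1 - t) * F r q" for r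
        unfolding F_def ALG_def expectation_mix_pmf[OF finite_det_algs pq *(3,4)]
        by (simp add: algebra_simps)
      then show "\<exists>z\<in>rand_algs R A n. \<forall>r\<in>I. F r z = t * F r p + (1 - t) * F r q"
        using mix_pmf_in_Delta[OF pq] by (auto simp: rand_algs_def)
    next
      fix p assume "p \<in> rand_algs R A n"
      then show "\<exists>r\<in>I. 0 \<le> F r p" using bad[of p] by (auto intro: less_imp_le)
    qed
    then obtain D where D: "D \<in> Delta I"
      "\<And>p. p \<in> rand_algs R A n \<Longrightarrow> 0 \<le> measure_pmf.expectation D (\<lambda>r. F r p)"
      by blast
    have D': "D \<in> Delta (nlists n R)" using D(1) by (auto simp: Delta_def I_def)
    \<comment> \<open>\<open>D\<close> lives on \<open>I\<close>, so its expected optimum is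
      positive, as \<open>le_ratio\<close> requires.\<close>
    have OPT_pos: "0 < measure_pmf.expectation D (OPT A f n)"
    proof -
      obtain r where "r \<in> set_pmf D" using set_pmf_not_empty by fast
      then have "r \<in> I" "0 < pmf D r" using D(1) by (auto simp: Delta_def pmf_positive)
      then show ?thesis
        unfolding expectation_Delta[OF \<open>finite I\<close> D(1)]
        using \<open>finite I\<close> by (intro sum_pos2[of _ r]) (auto simp: I_def)
    qed
    have "s \<le> (INF p\<in>rand_algs R A n. exp_ratio A f n p D)"
    proof (rule INF_greatest)
      fix p assume p: "p \<in> rand_algs R A n"
      have "c * measure_pmf.expectation D (ALG f n p) \<le> measure_pmf.expectation D (OPT A f n)"
        using D(2)[OF p]
        by (simp add: F_def expectation_diff_mult_Delta[OF finite_request_lists D'])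
      then show "s \<le> exp_ratio A f n p D"
        unfolding exp_ratio_def c(2)
        using OPT_pos expectation_ALG_bounds(1)[OF p D'] c(1) by (intro le_ratio) auto
    qed
    also have "\<dots> \<le> CR_bar R A f n (Delta_dep R n)"
      unfolding CR_bar_def using D' by (intro SUP_upper) (simp add: Delta_dep_def)
    finally show ?thesis .
  qed
qed

end


section \<open>Degenerate games and assembly of the chains\<close>

theorem theorem1:
  fixes R :: "'r set" and A :: "'a set" and f :: "'r list \<Rightarrow> 'a list \<Rightarrow> real" and n :: nat
  assumes "request_answer_game R A f n"
  shows
    "CR_bar R A f n (Delta_det R n) \<le> CR_bar R A f n (Delta_iid R n) \<and>
     CR_bar R A f n (Delta_iid R n) \<le> CR R A f n (Delta_iid R n) \<and>
     CR R A f n (Delta_iid R n) \<le> CR R A f n (Delta_rd R n) \<and>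
     CR R A f n (Delta_rd R n) = CR R A f n (Delta_ri R n) \<and>
     CR R A f n (Delta_ri R n) \<le> CR_bar R A f n (Delta_dep R n) \<and>
     CR_bar R A f n (Delta_dep R n) = CR R A f n (Delta_det R n) \<and>
     CR R A f n (Delta_det R n) = CR R A f n (Delta_ind R n) \<and>
     CR R A f n (Delta_ind R n) = CR R A f n (Delta_dep R n) \<and>

     CR_bar R A f n (Delta_det R n) \<le> CR_bar R A f n (Delta_rd R n) \<and>
     CR_bar R A f n (Delta_rd R n) \<le> CR_bar R A f n (Delta_ri R n) \<and>
     CR_bar R A f n (Delta_ri R n) \<le> CR R A f n (Delta_ri R n) \<and>

     CR_bar R A f n (Delta_iid R n) \<le> CR_bar R A f n (Delta_ri R n) \<and>

     CR_bar R A f n (Delta_iid R n) \<le> CR_bar R A f n (Delta_ind R n) \<and>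
     CR_bar R A f n (Delta_ind R n) \<le> CR_bar R A f n (Delta_dep R n)"
proof -
  interpret request_answer_game R A f n by (rule assms)
  have classes: "Delta_det R n \<subseteq> Delta_dep R n" "Delta_rd R n \<subseteq> Delta_dep R n"
    "Delta_iid R n \<subseteq> Delta_dep R n" "Delta_ri R n \<subseteq> Delta_dep R n"
    using Delta_det_subset_ind Delta_ind_subset_dep Delta_rd_subset_ri Delta_ri_subset_dep
      Delta_iid_subset_ri by blast+
  have nonempty: "Delta_det R n \<noteq> {}" "Delta_rd R n \<noteq> {}" "Delta_iid R n \<noteq> {}"
    "Delta_ri R n \<noteq> {}" "Delta_dep R n \<noteq> {}" if "R \<noteq> {}"
  proof -
    obtain r where r: "r \<in> nlists n R" using nlists_not_empty[OF \<open>R \<noteq> {}\<close>] by auto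
    show "Delta_det R n \<noteq> {}" using r by (auto simp: Delta_det_def)
    show "Delta_rd R n \<noteq> {}" using shuffle_pmf_in_Delta_rd[OF r] by auto
    show "Delta_iid R n \<noteq> {}" using return_replicate_in_Delta_iid \<open>R \<noteq> {}\<close> by fast
    with Delta_iid_subset_ri show "Delta_ri R n \<noteq> {}" by blast
    with Delta_ri_subset_dep show "Delta_dep R n \<noteq> {}" by blast
  qed
  \<comment> \<open>These are the inequalities that do not follow from inclusion of classes or from
    weak duality alone.\<close>
  have core: "CR_bar R A f n (Delta_det R n) \<le> CR_bar R A f n (Delta_iid R n) \<and>
    CR_bar R A f n (Delta_det R n) \<le> CR_bar R A f n (Delta_rd R n) \<and>
    CR R A f n (Delta_ri R n) \<le> CR R A f n (Delta_rd R n) \<and>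
    CR R A f n (Delta_dep R n) \<le> CR R A f n (Delta_det R n) \<and>
    CR R A f n (Delta_det R n) \<le> CR_bar R A f n (Delta_dep R n)"
  proof (cases "R = {} \<or> A = {}")
    case False
    then interpret nonempty_request_answer_game R A f n
      by unfold_locales auto
    show ?thesis
      using False nonempty classes CR_bar_det_le CR_ri_le_rd CR_dep_le_det CR_det_le_CR_bar_dep
      by (simp add: Delta_dep_def)
  next
    case True
    show ?thesis
    proof (cases "R = {}")
      case True
      \<comment> \<open>All classes are empty, so every supremum over them is 0. An algorithm still
        exists, which keeps the outer infimum in \<open>CR\<close> at 0 rather than at
        \<open>top\<close>.\<close>
      have no_requests: "nlists i R = {}" if "i > 0" for i
      proof (rule equals0I)
        fix r assume "r \<in> nlists i R"
        from nlistsE_set[OF this] nlistsE_length[OF this] show False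
          using True that by simp
      qed
      then have "nlists n R = {}" using n_pos by blast
      then have "Delta_dep R n = {}"
        by (auto simp: Delta_dep_def Delta_def set_pmf_not_empty)
      with classes have empty: "Delta_det R n = {}" "Delta_iid R n = {}" "Delta_rd R n = {}"
        "Delta_ri R n = {}" "Delta_dep R n = {}" by auto
      have "(\<lambda>i\<in>{1..n}. \<lambda>s. undefined) \<in> det_algs R A n"
        by (auto simp: det_algs_def no_requests)
      then have "rand_algs R A n \<noteq> {}"
        by (auto simp: rand_algs_def Delta_def intro!: exI[of _ "return_pmf _"])
      then show ?thesis
        unfolding empty by (simp add: CR_def CR_bar_def)
    next
      case False
      \<comment> \<open>There is no algorithm, so every infimum is \<open>top\<close>; as the
        classes involved are nonempty, \<open>CR_bar\<close> is \<open>top\<close> as well.\<close>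
      then have "A = {}" using True by simp
      moreover have "nlists 1 R \<noteq> {}" using nlists_not_empty[OF False] by auto
      ultimately have "(nlists 1 R \<rightarrow>\<^sub>E A) = {}" by (auto simp: PiE_eq_empty_iff)
      then have "det_algs R A n = {}"
        using n_pos unfolding det_algs_def PiE_eq_empty_iff by (intro bexI[of _ 1]) auto
      then have "rand_algs R A n = {}"
        by (auto simp: rand_algs_def Delta_def set_pmf_not_empty)
      then show ?thesis
        using nonempty[OF False] by (simp add: CR_def CR_bar_def)
    qed
  qed
  note mono_CR = CR_mono[of _ _ R A f n]
  note mono_CR_bar = CR_bar_mono[of _ _ R A f n]
  note duality = CR_bar_le_CR[of R A f n]
  have rd_ri: "CR R A f n (Delta_rd R n) = CR R A f n (Delta_ri R n)"
    using core mono_CR[OF Delta_rd_subset_ri] by (simp add: order.antisym)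
  have det_ind: "CR R A f n (Delta_det R n) \<le> CR R A f n (Delta_ind R n)"
    and ind_dep: "CR R A f n (Delta_ind R n) \<le> CR R A f n (Delta_dep R n)"
    by (rule mono_CR[OF Delta_det_subset_ind], rule mono_CR[OF Delta_ind_subset_dep])
  \<comment> \<open>The ratios \<open>CR\<close> for det, ind and dep form a cycle of inequalities;
    \<open>CR_bar\<close> for dep is caught between those for det and dep.\<close>
  have collapse: "CR R A f n (Delta_det R n) = CR R A f n (Delta_ind R n)"
    "CR R A f n (Delta_ind R n) = CR R A f n (Delta_dep R n)"
    "CR_bar R A f n (Delta_dep R n) = CR R A f n (Delta_dep R n)"
    using core det_ind ind_dep duality[of "Delta_dep R n"] by (meson order.antisym order.trans)+
  show ?thesis
    unfolding collapse rd_ri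
    using core mono_CR[OF Delta_iid_subset_ri] mono_CR[OF Delta_ri_subset_dep]
      mono_CR_bar[OF Delta_rd_subset_ri] mono_CR_bar[OF Delta_iid_subset_ri]
      mono_CR_bar[OF Delta_iid_subset_ind] mono_CR_bar[OF Delta_ind_subset_dep[of R n]]
      duality collapse by simp
qed

end
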